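(* Let $\mathfrak g:\mathrm{Sym}^2(\mathbb R^n)\to\mathbb R$ be a Gårding–Dirichlet polynomial of degree $m$. For $k=1,\dots,m-1$, the set $\mathrm{Int}\,\mathbf\Lambda_k^{\sigma_{m-1}^{\mathfrak g}}$ is a disjoint union $$\mathrm{Int}\,\mathbf\Lambda_k^{\sigma_{m-1}^{\mathfrak g}}=\left((\mathrm{Int}\,\mathbf\Lambda_{k+1}^{\mathfrak g})\cap\mathbf\Lambda_k^{\mathfrak g}\right)\cup E_k,\qquad E_k=\left((\mathrm{Int}\,\mathbf\Lambda_{k+1}^{\mathfrak g})\setminus\mathbf\Lambda_k^{\mathfrak g}\right)\cap\{A:\sigma_{m-1}^{\mathfrak g}(A)\,\sigma_m^{\mathfrak g}(A)<0\}.$$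
   Context: $\mathrm{Sym}^2(\mathbb R^n)$ is the space of real symmetric $n\times n$ matrices and $\mathcal P=\{A\ge0\}$. A homogeneous polynomial $\mathfrak g$ of degree $m$ on $\mathrm{Sym}^2(\mathbb R^n)$ is Gårding hyperbolic with respect to $I$ if $\mathfrak g(I)\neq0$ and for every $A$ all roots of $t\mapsto\mathfrak g(tI+A)$ are real. The negatives of these roots, in increasing order with multiplicity, are the Gårding eigenvalues $\lambda_1^{\mathfrak g}(A)\le\dots\le\lambda_m^{\mathfrak g}(A)$. The Gårding cone is $\Gamma=\{A:\lambda_1^{\mathfrak g}(A)>0\}$. $\mathfrak g$ is a Gårding–Dirichlet polynomial if it is Gårding hyperbolic with respect to $I$ and $\mathcal P\subset\overline\Gamma$. The branches are $\mathbf\Lambda_k^{\mathfrak g}=\{A:\lambda_k^{\mathfrak g}(A)\ge0\}$, $k=1,\dots,m$. $\sigma_j^{\mathfrak g}(A)$ is the $j$-th elementary symmetric function of $\lambda_1^{\mathfrak g}(A),\dots,\lambda_m^{\mathfrak g}(A)$. The polynomial $\sigma_{m-1}^{\mathfrak g}$ is homogeneous of degree $m-1$ and Gårding hyperbolic with respect to $I$; $\mathbf\Lambda_k^{\sigma_{m-1}^{\mathfrak g}}$, $k=1,\dots,m-1$, is the set of $A$ whose $k$-th ordered Gårding eigenvalue with respect to $\sigma_{m-1}^{\mathfrak g}$ (negative of a root of $t\mapsto\sigma_{m-1}^{\mathfrak g}(tI+A)$) is $\ge0$. *)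

theory Defs
  imports "HOL-Analysis.Analysis" "HOL-Computational_Algebra.Polynomial" "HOL-Library.Multiset"
begin

text \<open>
  The space \<open>Sym\<^sup>2(\<real>\<^sup>n)\<close> is a subspace of the space of all real \<open>n \<times> n\<close> matrices. Functions on it are
  represented by functions on all matrices, of which only the values at symmetric matrices are
  used. All topological notions below are relative to \<open>Sym2\<close>, which as a subset of the space of all
  matrices has empty interior as soon as \<open>n \<ge> 2\<close>.
\<close>

definition Sym2 :: "(real^'n^'n) set" where
  "Sym2 = {A. transpose A = A}"

definition PSD :: "(real^'n^'n) set" where
  "PSD = {A \<in> Sym2. \<forall>x. 0 \<le> x \<bullet> (A *v x)}"

abbreviation sym_interior :: "(real^'n^'n) set \<Rightarrow> (real^'n^'n) set" where
  "sym_interior S \<equiv> top_of_set Sym2 interior_of S"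

abbreviation sym_closure :: "(real^'n^'n) set \<Rightarrow> (real^'n^'n) set" where
  "sym_closure S \<equiv> top_of_set Sym2 closure_of S"

definition homogeneous_polynomial :: "nat \<Rightarrow> (real^'n^'n \<Rightarrow> real) \<Rightarrow> bool" where
  "homogeneous_polynomial m g \<longleftrightarrow>
     (\<exists>p. real_polynomial_function p \<and> (\<forall>A\<in>Sym2. g A = p A)) \<and>
     (\<forall>c. \<forall>A\<in>Sym2. g (c *\<^sub>R A) = c ^ m * g A)"

text \<open>The univariate polynomial \<open>t \<mapsto> g(tI + A)\<close>; see \<open>poly_line_poly\<close> for existence and uniqueness.\<close>

definition line_poly :: "(real^'n^'n \<Rightarrow> real) \<Rightarrow> real^'n^'n \<Rightarrow> real poly" where
  "line_poly g A = (THE p. \<forall>t. poly p t = g (t *\<^sub>R mat 1 + A))"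

definition garding_hyperbolic :: "nat \<Rightarrow> (real^'n^'n \<Rightarrow> real) \<Rightarrow> bool" where
  "garding_hyperbolic m g \<longleftrightarrow>
     homogeneous_polynomial m g \<and> g (mat 1) \<noteq> 0 \<and>
     (\<forall>A\<in>Sym2. \<forall>z::complex. poly (map_poly complex_of_real (line_poly g A)) z = 0 \<longrightarrow> z \<in> \<real>)"

text \<open>
  The Garding eigenvalues in increasing order, with multiplicity. For \<open>g\<close> hyperbolic of degree \<open>m\<close>
  this list has length \<open>m\<close>, since then \<open>line_poly g A\<close> has degree \<open>m\<close> and splits over the reals.
\<close>

definition garding_eigenvalues :: "(real^'n^'n \<Rightarrow> real) \<Rightarrow> real^'n^'n \<Rightarrow> real list" where
  "garding_eigenvalues g A = sorted_list_of_multiset (image_mset uminus (proots (line_poly g A)))"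

text \<open>Eigenvalues are numbered from 1, list positions from 0.\<close>

definition garding_eigenvalue :: "(real^'n^'n \<Rightarrow> real) \<Rightarrow> nat \<Rightarrow> real^'n^'n \<Rightarrow> real" where
  "garding_eigenvalue g k A = garding_eigenvalues g A ! (k - 1)"

definition garding_cone :: "(real^'n^'n \<Rightarrow> real) \<Rightarrow> (real^'n^'n) set" where
  "garding_cone g = {A \<in> Sym2. 0 < garding_eigenvalue g 1 A}"

definition garding_dirichlet :: "nat \<Rightarrow> (real^'n^'n \<Rightarrow> real) \<Rightarrow> bool" where
  "garding_dirichlet m g \<longleftrightarrow>
     garding_hyperbolic m g \<and> PSD \<subseteq> sym_closure (garding_cone g)"

definition branch :: "(real^'n^'n \<Rightarrow> real) \<Rightarrow> nat \<Rightarrow> (real^'n^'n) set" where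
  "branch g k = {A \<in> Sym2. 0 \<le> garding_eigenvalue g k A}"

definition elem_sym :: "nat \<Rightarrow> real list \<Rightarrow> real" where
  "elem_sym j xs = (\<Sum>I | I \<subseteq> {..<length xs} \<and> card I = j. \<Prod>i\<in>I. xs ! i)"

definition garding_sigma :: "(real^'n^'n \<Rightarrow> real) \<Rightarrow> nat \<Rightarrow> real^'n^'n \<Rightarrow> real" where
  "garding_sigma g j A = elem_sym j (garding_eigenvalues g A)"

definition E_set :: "(real^'n^'n \<Rightarrow> real) \<Rightarrow> nat \<Rightarrow> nat \<Rightarrow> (real^'n^'n) set" where
  "E_set g m k =
     (sym_interior (branch g (k + 1)) - branch g k) \<inter>
     {A \<in> Sym2. garding_sigma g (m - 1) A * garding_sigma g m A < 0}"

lemma real_polynomial_function_line: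
  assumes "real_polynomial_function f"
  shows "\<exists>p. \<forall>t. poly p t = f (t *\<^sub>R B + A)"
  using assms
proof induction
  case (linear f)
  then have "f (t *\<^sub>R B + A) = t * f B + f A" for t
    by (simp add: bounded_linear.linear linear_add linear_scale)
  then show ?case
    by (intro exI[of _ "[:f A, f B:]"]) (simp add: algebra_simps)
next
  case (const c)
  then show ?case by (intro exI[of _ "[:c:]"]) simp
next
  case (add f g)
  then obtain p q where "\<forall>t. poly p t = f (t *\<^sub>R B + A)" "\<forall>t. poly q t = g (t *\<^sub>R B + A)" by blast
  then show ?case by (intro exI[of _ "p + q"]) simp
next
  case (mult f g)
  then obtain p q where "\<forall>t. poly p t = f (t *\<^sub>R B + A)" "\<forall>t. poly q t = g (t *\<^sub>R B + A)" by blast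
  then show ?case by (intro exI[of _ "p * q"]) simp
qed

lemma line_in_Sym2: "A \<in> Sym2 \<Longrightarrow> t *\<^sub>R mat 1 + A \<in> Sym2"
  by (auto simp: Sym2_def transpose_def mat_def vec_eq_iff)

lemma poly_line_poly:
  assumes "homogeneous_polynomial m g" and "A \<in> Sym2"
  shows "poly (line_poly g A) t = g (t *\<^sub>R mat 1 + A)"
    and "(\<forall>t. poly q t = g (t *\<^sub>R mat 1 + A)) \<Longrightarrow> line_poly g A = q"
proof -
  obtain f where f: "real_polynomial_function f" "\<forall>A\<in>Sym2. g A = f A"
    using assms(1) unfolding homogeneous_polynomial_def by blast
  obtain p where p: "\<forall>t. poly p t = g (t *\<^sub>R mat 1 + A)"
    using real_polynomial_function_line[OF f(1)] f(2) line_in_Sym2[OF assms(2)] by metis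
  have uniq: "\<exists>!p. \<forall>t. poly p t = g (t *\<^sub>R mat 1 + A)"
  proof (rule ex1I[of _ p])
    show "\<forall>t. poly p t = g (t *\<^sub>R mat 1 + A)" by (fact p)
    fix r assume "\<forall>t. poly r t = g (t *\<^sub>R mat 1 + A)"
    with p have "poly r = poly p" by (intro ext) simp
    then show "r = p" by (simp add: poly_eq_poly_eq_iff)
  qed
  show "poly (line_poly g A) t = g (t *\<^sub>R mat 1 + A)"
    using theI'[OF uniq] unfolding line_poly_def by blast
  show "line_poly g A = q" if "\<forall>t. poly q t = g (t *\<^sub>R mat 1 + A)"
    using the1_equality[OF uniq that] unfolding line_poly_def .
qed

end

theory Submission
  imports Defs "HOL-Computational_Algebra.Fundamental_Theorem_Algebra"
begin

text \<open>
  For \<open>p t = g (t I + A)\<close>, the polynomial \<open>t \<mapsto> \<sigma>\<^sub>m\<^sub>-\<^sub>1 (t I + A)\<close> is \<open>p'\<close> up to a nonzero constant, and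
  \<open>\<sigma>\<^sub>m\<^sub>-\<^sub>1 \<sigma>\<^sub>m\<close> at \<open>A\<close> has the sign of \<open>p' p\<close> at \<open>0\<close>. Eigenvalues are negatives of roots, so the \<open>k\<close>-th one
  is nonnegative iff fewer than \<open>k\<close> roots are positive, and positive iff fewer than \<open>k\<close> roots are
  nonnegative. The latter condition is the interior of the former: it is open because root counts of
  real-rooted polynomials are stable, and a translation of \<open>A\<close> by a small negative multiple of \<open>I\<close>
  separates the two. It remains to compare the root counts of \<open>p\<close> and \<open>p'\<close>: by Rolle's theorem, with
  multiplicities, \<open>p'\<close> loses at most one root in every interval, and the sign of \<open>p p'\<close> at a point that
  is a root of neither tells on which side of the point the root is lost.
\<close>

section \<open>Root counts with multiplicity for polynomials that split over the reals\<close>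

definition roots_in :: "real poly \<Rightarrow> real set \<Rightarrow> nat" where
  "roots_in p S = size {#x \<in># proots p. x \<in> S#}"

text \<open>Zero has to be excluded explicitly: its \<open>proots\<close> is empty and its degree is
  0, so it satisfies the equation.\<close>

definition real_rooted :: "real poly \<Rightarrow> bool" where
  "real_rooted p \<longleftrightarrow> p \<noteq> 0 \<and> size (proots p) = degree p"

lemma roots_in_mono: "S \<subseteq> T \<Longrightarrow> roots_in p S \<le> roots_in p T"
  unfolding roots_in_def by (intro size_mset_mono mset_subset_eqI) auto

lemma roots_in_Un_disjoint:
  assumes "S \<inter> T = {}"
  shows "roots_in p (S \<union> T) = roots_in p S + roots_in p T"
proof -
  have "{#x \<in># proots p. x \<in> S \<union> T#} = {#x \<in># proots p. x \<in> S#} + {#x \<in># proots p. x \<in> T#}"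
    by (rule multiset_eqI) (use assms in auto)
  then show ?thesis
    by (simp add: roots_in_def)
qed

lemma roots_in_UNIV: "real_rooted p \<Longrightarrow> roots_in p UNIV = degree p"
  by (simp add: roots_in_def real_rooted_def)

lemma roots_in_le_degree: "roots_in p S \<le> degree p"
  unfolding roots_in_def using size_filter_mset_lesseq size_proots_le le_trans by blast

lemma roots_in_cong:
  assumes "\<And>x. poly p x = 0 \<Longrightarrow> x \<in> S \<longleftrightarrow> x \<in> T"
  shows "roots_in p S = roots_in p T"
proof (cases "p = 0")
  case False
  then show ?thesis
    unfolding roots_in_def by (intro arg_cong[where f = size] filter_mset_cong) (auto simp: assms)
qed (simp add: roots_in_def)

lemma roots_in_singleton: "p \<noteq> 0 \<Longrightarrow> roots_in p {a} = order a p"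
  by (simp add: roots_in_def filter_eq_replicate_mset)

lemma roots_in_eq_sum_order:
  assumes "p \<noteq> 0"
  shows "roots_in p S = (\<Sum>x\<in>{x \<in> S. poly p x = 0}. order x p)"
proof -
  have "{x. (x \<in> S \<longrightarrow> poly p x = 0) \<and> x \<in> S} = {x \<in> S. poly p x = 0}"
    by auto
  then show ?thesis
    using assms by (simp add: roots_in_def size_multiset_overloaded_eq Int_def conj_commute)
qed

text \<open>The induction splits off all factors belonging to one real root at a time;
  \<open>q\<close> is what remains when no real root is left.\<close>

lemma proots_factor:
  fixes p :: "real poly"
  assumes "p \<noteq> 0"
  shows "\<exists>q. p = (\<Prod>a\<in>#proots p. [:-a, 1:]) * q \<and> (\<forall>x. poly q x \<noteq> 0)"
  using assms
proof (induction p rule: poly_root_order_induct)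
  case (no_roots p)
  then have "proots p = {#}"
    by (simp add: multiset_eqI order_root)
  then show ?case
    using no_roots by auto
next
  case (root p x n)
  then obtain q where q: "p = (\<Prod>a\<in>#proots p. [:-a, 1:]) * q" "\<forall>x. poly q x \<noteq> 0"
    by auto
  have "proots ([:-x, 1:] ^ n * p) = replicate_mset n x + proots p"
    using root.prems by (subst proots_mult) (auto simp: proots_power intro!: multiset_eqI)
  then have "[:-x, 1:] ^ n * p = (\<Prod>a\<in>#proots ([:-x, 1:] ^ n * p). [:-a, 1:]) * q"
    using q(1) by (simp add: mult.assoc)
  then show ?case
    using q(2) by blast
qed auto

lemma degree_prod_linear_factors [simp]:
  "degree (\<Prod>a\<in>#M. [:- a, 1:] :: real poly) = size M"
  "lead_coeff (\<Prod>a\<in>#M. [:- a, 1:] :: real poly) = 1"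
  "(\<Prod>a\<in>#M. [:- a, 1:] :: real poly) \<noteq> 0"
proof -
  show nz: "(\<Prod>a\<in>#M. [:- a, 1:] :: real poly) \<noteq> 0" for M :: "real multiset"
    by auto
  show "degree (\<Prod>a\<in>#M. [:- a, 1:] :: real poly) = size M"
    by (induction M) (simp_all add: degree_mult_eq[OF _ nz] del: mult_pCons_left)
  show "lead_coeff (\<Prod>a\<in>#M. [:- a, 1:] :: real poly) = 1"
    by (induction M) (simp_all add: lead_coeff_mult del: mult_pCons_left)
qed

lemma real_rooted_factor:
  assumes "real_rooted p"
  shows "p = smult (lead_coeff p) (\<Prod>a\<in>#proots p. [:-a, 1:])"
proof -
  let ?P = "\<Prod>a\<in>#proots p. [:-a, 1:] :: real poly"
  have "p \<noteq> 0" and deg: "size (proots p) = degree p"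
    using assms by (auto simp: real_rooted_def)
  then obtain q where q: "p = ?P * q"
    using proots_factor by blast
  with \<open>p \<noteq> 0\<close> have "q \<noteq> 0"
    by auto
  then have "degree p = degree p + degree q"
    by (subst (1) q) (simp add: degree_mult_eq[OF degree_prod_linear_factors(3)] deg)
  then obtain c where c: "q = [:c:]"
    by (metis add_cancel_right_right degree_eq_zeroE)
  then have "lead_coeff p = c"
    using degree_prod_linear_factors(2)[of "proots p"] by (subst q) (simp add: deg)
  with q c show ?thesis
    by simp
qed

lemma map_poly_of_real_mult:
  "map_poly complex_of_real (p * q) = map_poly complex_of_real p * map_poly complex_of_real q"
  by (rule poly_eqI) (simp add: coeff_map_poly coeff_mult)

text \<open>Split off all real roots. A nonconstant cofactor would have a complex root, which is
  also a root of \<open>p\<close> and hence real, but the cofactor has no real roots.\<close>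

lemma real_rootedI:
  assumes "p \<noteq> 0"
    and real: "\<And>z. poly (map_poly complex_of_real p) z = 0 \<Longrightarrow> z \<in> \<real>"
  shows "real_rooted p"
proof -
  let ?P = "\<Prod>a\<in>#proots p. [:-a, 1:] :: real poly"
  obtain q where q: "p = ?P * q" and nr: "\<And>x. poly q x \<noteq> 0"
    using proots_factor[OF assms(1)] by blast
  have [simp]: "q \<noteq> 0"
    using nr[of 0] by auto
  have "degree q = 0"
  proof (rule ccontr)
    assume "degree q \<noteq> 0"
    moreover have "degree (map_poly complex_of_real q) = degree q"
      by (rule degree_map_poly) simp
    ultimately have "\<not> constant (poly (map_poly complex_of_real q))"
      by (simp add: constant_degree)
    then obtain z where z: "poly (map_poly complex_of_real q) z = 0"
      using fundamental_theorem_of_algebra by blast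
    have "poly (map_poly complex_of_real p) z = 0"
      by (subst q) (simp add: map_poly_of_real_mult z)
    then obtain x where "z = of_real x"
      using real Reals_cases by blast
    with z have "complex_of_real (poly q x) = 0"
      by (simp add: poly_altdef coeff_map_poly degree_map_poly)
    with nr show False
      by simp
  qed
  then have "degree p = size (proots p)"
    by (subst q) (simp add: degree_mult_eq[OF degree_prod_linear_factors(3)])
  with assms(1) show ?thesis
    by (simp add: real_rooted_def)
qed

text \<open>In the factorization of \<open>p\<close>, exactly the roots to the right of
  \<open>t\<close> contribute negative factors.\<close>

lemma sgn_poly_real_rooted:
  assumes "real_rooted p" "poly p t \<noteq> 0"
  shows "sgn (poly p t) = sgn (lead_coeff p) * (- 1) ^ roots_in p {t<..}"
proof -
  have *: "sgn (\<Prod>a\<in>#M. t - a) = (- 1) ^ size {#x \<in># M. x \<in> {t<..}#}"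
    if "t \<notin># M" for M :: "real multiset"
    using that
  proof (induction M)
    case (add x M)
    then have "sgn (t - x) = (if t < x then - 1 else 1)"
      by (auto simp: sgn_if)
    with add show ?case
      by (simp add: sgn_mult)
  qed simp
  have "poly p t = lead_coeff p * (\<Prod>a\<in>#proots p. t - a)"
    by (subst real_rooted_factor[OF assms(1)]) (simp add: poly_prod_mset image_mset.compositionality o_def)
  moreover have "t \<notin># proots p"
    using assms by (auto simp: real_rooted_def)
  ultimately show ?thesis
    using * by (simp add: sgn_mult roots_in_def)
qed

section \<open>Rolle's theorem with multiplicities, and the sign rule\<close>

text \<open>Differentiation lowers the order of each distinct root in \<open>I\<close> by one, and
  each gap between neighbouring roots supplies a new root of the derivative. There is one gap fewer
  than there are roots, which leaves a loss of at most one.\<close>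

lemma roots_in_le_Suc_pderiv:
  assumes "pderiv p \<noteq> 0" and I: "is_interval I"
  shows "roots_in p I \<le> Suc (roots_in (pderiv p) I)"
proof -
  have "p \<noteq> 0"
    using assms(1) by auto
  define D where "D = {x \<in> I. poly p x = 0}"
  have fin: "finite D"
    unfolding D_def using poly_roots_finite[OF \<open>p \<noteq> 0\<close>] by (rule finite_subset[rotated]) auto
  show ?thesis
  proof (cases "D = {}")
    case True
    then show ?thesis
      using roots_in_eq_sum_order[OF \<open>p \<noteq> 0\<close>, of I, folded D_def] by simp
  next
    case False
    \<comment> \<open>The new root is taken before the next element of \<open>D\<close>. This keeps
      it outside \<open>D\<close> and makes the choices for different \<open>a\<close>
      distinct.\<close>
    have "\<exists>c. a < c \<and> poly (pderiv p) c = 0 \<and> c \<in> I - D \<and> (\<forall>d\<in>D. a < d \<longrightarrow> c < d)"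
      if a: "a \<in> D - {Max D}" for a
    proof -
      let ?D' = "{d \<in> D. a < d}"
      have D': "finite ?D'" "?D' \<noteq> {}"
        using fin a Max_ge[OF fin, of a] Max_in[OF fin False]
        by (auto intro!: exI[of _ "Max D"] simp: less_le)
      define b where "b = Min ?D'"
      have b: "b \<in> D" "a < b" and least: "\<And>d. d \<in> D \<Longrightarrow> a < d \<Longrightarrow> b \<le> d"
        using Min_in[OF D'] Min_le[OF D'(1)] by (auto simp: b_def)
      obtain c where c: "a < c" "c < b" "poly p b - poly p a = (b - a) * poly (pderiv p) c"
        using poly_MVT[OF b(2)] by blast
      have ab: "poly p a = 0" "poly p b = 0" "a \<in> I" "b \<in> I"
        using a b(1) by (simp_all add: D_def)
      have "poly (pderiv p) c = 0"
        using c(3) ab b(2) by simp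
      moreover have "c \<in> I"
        using I ab(3,4) c(1,2) unfolding is_interval_1 by (meson less_imp_le)
      moreover have "c \<notin> D"
        using least c(1,2) by (meson leD)
      moreover have "c < d" if "d \<in> D" "a < d" for d
        using c(2) least[OF that] by linarith
      ultimately show ?thesis
        using c(1) by blast
    qed
    then obtain f where f: "\<And>a. a \<in> D - {Max D} \<Longrightarrow>
        a < f a \<and> poly (pderiv p) (f a) = 0 \<and> f a \<in> I - D \<and> (\<forall>d\<in>D. a < d \<longrightarrow> f a < d)"
      by metis
    have inj: "inj_on f (D - {Max D})"
    proof (rule linorder_inj_onI')
      fix a b assume ab: "a \<in> D - {Max D}" "b \<in> D - {Max D}" "a < b"
      then have "f a < b" "b < f b"
        using f by blast+
      then show "f a \<noteq> f b"
        by simp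
    qed
    let ?C = "f ` (D - {Max D})"
    let ?R = "{x \<in> I. poly (pderiv p) x = 0}"
    have finR: "finite ?R"
      using poly_roots_finite[OF assms(1)] by (rule finite_subset[rotated]) auto
    have "card D - 1 = card ?C"
      using inj fin False by (simp add: card_image)
    also have "\<dots> \<le> (\<Sum>x\<in>?C. order x (pderiv p))"
    proof -
      have "1 \<le> order x (pderiv p)" if "x \<in> ?C" for x
        using that f assms(1) by (force simp: Suc_le_eq order_gt_0_iff)
      then show ?thesis
        using sum_mono[of ?C "\<lambda>_. 1 :: nat"] by fastforce
    qed
    also have "\<dots> \<le> (\<Sum>x\<in>?R - D. order x (pderiv p))"
      by (rule sum_mono2) (use finR f in auto)
    finally have new: "card D - 1 \<le> (\<Sum>x\<in>?R - D. order x (pderiv p))" .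
    have ord: "order x p = Suc (order x (pderiv p))" if "x \<in> D" for x
      using that \<open>p \<noteq> 0\<close> by (intro order_pderiv) (auto simp: D_def)
    have "roots_in p I = (\<Sum>x\<in>D. Suc (order x (pderiv p)))"
      unfolding roots_in_eq_sum_order[OF \<open>p \<noteq> 0\<close>] using ord by (auto simp: D_def)
    also have "\<dots> = card D + (\<Sum>x\<in>D. order x (pderiv p))"
      unfolding Suc_eq_plus1_left sum.distrib by simp
    \<comment> \<open>Simple roots of \<open>p\<close> are not roots of the derivative; their order
      there is 0.\<close>
    also have "(\<Sum>x\<in>D. order x (pderiv p)) = (\<Sum>x\<in>?R \<inter> D. order x (pderiv p))"
      by (rule sum.mono_neutral_right) (use fin assms(1) order_root in \<open>auto simp: D_def\<close>)
    finally have "roots_in p I \<le> Suc ((\<Sum>x\<in>?R - D. order x (pderiv p)) + (\<Sum>x\<in>?R \<inter> D. order x (pderiv p)))"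
      using new False fin card_gt_0_iff[of D] by linarith
    also have "(\<Sum>x\<in>?R - D. order x (pderiv p)) + (\<Sum>x\<in>?R \<inter> D. order x (pderiv p))
        = roots_in (pderiv p) I"
      unfolding roots_in_eq_sum_order[OF assms(1)]
      using sum.Int_Diff[OF finR, of "\<lambda>x. order x (pderiv p)" D] by simp
    finally show ?thesis .
  qed
qed

lemma real_rooted_pderiv:
  assumes "real_rooted p" "degree p > 0"
  shows "real_rooted (pderiv p)"
proof -
  have nz: "pderiv p \<noteq> 0"
    using assms by (simp add: pderiv_eq_0_iff)
  have "degree p \<le> Suc (roots_in (pderiv p) UNIV)"
    using roots_in_le_Suc_pderiv[OF nz, of UNIV] roots_in_UNIV[OF assms(1)] by simp
  then show ?thesis
    using nz roots_in_le_degree[of "pderiv p" UNIV] size_proots_le[of "pderiv p"]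
    by (simp add: real_rooted_def roots_in_def degree_pderiv)
qed

lemma roots_in_lessThan_greaterThan:
  assumes "real_rooted p" "poly p t \<noteq> 0"
  shows "roots_in p {..<t} + roots_in p {t<..} = degree p"
proof -
  have "roots_in p UNIV = roots_in p ({..<t} \<union> {t<..})"
  proof (rule roots_in_cong)
    fix x assume "poly p x = 0"
    with assms(2) have "x \<noteq> t"
      by auto
    then show "x \<in> UNIV \<longleftrightarrow> x \<in> {..<t} \<union> {t<..}"
      by auto
  qed
  also have "\<dots> = roots_in p {..<t} + roots_in p {t<..}"
    by (rule roots_in_Un_disjoint) auto
  finally show ?thesis
    using roots_in_UNIV[OF assms(1)] by simp
qed

text \<open>Each side of \<open>t\<close> loses at most one root and both sides together lose
  exactly one. The sign of the product at \<open>t\<close> gives the parity of the sum of the two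
  right-hand counts, which decides the side.\<close>

lemma roots_in_greaterThan_pderiv:
  assumes rr: "real_rooted p" and deg: "degree p > 0"
    and nz: "poly p t \<noteq> 0" "poly (pderiv p) t \<noteq> 0"
  shows "roots_in p {t<..} =
    roots_in (pderiv p) {t<..} + (if poly p t * poly (pderiv p) t < 0 then 1 else 0)"
proof -
  let ?q = "pderiv p"
  have rr': "real_rooted ?q"
    by (rule real_rooted_pderiv[OF rr deg])
  have q0: "?q \<noteq> 0"
    using rr' by (simp add: real_rooted_def)
  have "roots_in p {t<..} \<le> Suc (roots_in ?q {t<..})" "roots_in p {..<t} \<le> Suc (roots_in ?q {..<t})"
    by (auto intro!: roots_in_le_Suc_pderiv[OF q0] simp: is_interval_1)
  moreover have "roots_in p {..<t} + roots_in p {t<..} = degree p"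
    "roots_in ?q {..<t} + roots_in ?q {t<..} = degree p - 1"
    using roots_in_lessThan_greaterThan[OF rr nz(1)] roots_in_lessThan_greaterThan[OF rr' nz(2)] by (simp_all add: degree_pderiv)
  ultimately consider "roots_in p {t<..} = roots_in ?q {t<..}"
    | "roots_in p {t<..} = Suc (roots_in ?q {t<..})"
    using deg by linarith
  moreover have sgn: "sgn (poly p t * poly ?q t) = (- 1) ^ (roots_in p {t<..} + roots_in ?q {t<..})"
  proof -
    have "lead_coeff ?q = real (degree p) * lead_coeff p"
      using deg by (simp add: coeff_pderiv degree_pderiv del: of_nat_Suc)
    then have "sgn (lead_coeff ?q) = sgn (lead_coeff p)"
      using deg by (simp add: sgn_mult)
    moreover have "sgn (lead_coeff p) * sgn (lead_coeff p) = 1"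
      using rr by (auto simp: real_rooted_def sgn_if)
    ultimately show ?thesis
      unfolding sgn_mult sgn_poly_real_rooted[OF rr nz(1)] sgn_poly_real_rooted[OF rr' nz(2)]
      by (simp add: power_add mult_ac)
  qed
  ultimately show ?thesis
  proof cases
    case 1
    with sgn have "sgn (poly p t * poly ?q t) = 1"
      by (simp flip: mult_2)
    with 1 show ?thesis
      by (simp add: sgn_1_pos)
  next
    case 2
    with sgn have "sgn (poly p t * poly ?q t) = - 1"
      by (simp flip: mult_2)
    with 2 show ?thesis
      by (simp add: sgn_1_neg)
  qed
qed

section \<open>Stability of root counts under perturbation\<close>

lemma tendsto_poly_coeffs:
  fixes P :: "'a \<Rightarrow> real poly"
  assumes deg: "\<forall>\<^sub>F B in F. degree (P B) = degree p"
    and conv: "\<And>i. ((\<lambda>B. coeff (P B) i) \<longlongrightarrow> coeff p i) F"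
  shows "((\<lambda>B. poly (P B) s) \<longlongrightarrow> poly p s) F"
proof -
  have "((\<lambda>B. \<Sum>i\<le>degree p. coeff (P B) i * s ^ i) \<longlongrightarrow> poly p s) F"
    unfolding poly_altdef by (intro tendsto_intros conv)
  moreover have "\<forall>\<^sub>F B in F. (\<Sum>i\<le>degree p. coeff (P B) i * s ^ i) = poly (P B) s"
    using deg by eventually_elim (simp add: poly_altdef)
  ultimately show ?thesis
    by (rule Lim_transform_eventually)
qed

text \<open>
  Induction on the degree: by \<open>roots_in_greaterThan_pderiv\<close> the counts for \<open>p\<close> and its derivative
  differ by an amount that depends only on the sign of \<open>p p'\<close> at \<open>s\<close>, which is stable. This replaces
  the continuity of the ordered roots.
\<close>

lemma eventually_roots_in_greaterThan_eq:
  fixes P :: "'a \<Rightarrow> real poly"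
  assumes "real_rooted p"
    and "\<forall>\<^sub>F B in F. real_rooted (P B) \<and> degree (P B) = degree p"
    and "\<And>i. ((\<lambda>B. coeff (P B) i) \<longlongrightarrow> coeff p i) F"
    and "\<And>j. j \<le> degree p \<Longrightarrow> poly ((pderiv ^^ j) p) s \<noteq> 0"
  shows "\<forall>\<^sub>F B in F. roots_in (P B) {s<..} = roots_in p {s<..}"
  using assms
proof (induction "degree p" arbitrary: p P)
  case 0
  then show ?case
    using roots_in_le_degree[of p "{s<..}"]
    by (elim eventually_mono) (metis le_zero_eq roots_in_le_degree)
next
  case (Suc n)
  have deg': "degree (pderiv p) = n"
    using Suc.hyps(2) by (simp add: degree_pderiv)
  have ev: "\<forall>\<^sub>F B in F. real_rooted (pderiv (P B)) \<and> degree (pderiv (P B)) = degree (pderiv p)"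
    using Suc.prems(2) by eventually_elim (use Suc.hyps(2) in \<open>simp add: real_rooted_pderiv degree_pderiv\<close>)
  have conv: "((\<lambda>B. coeff (pderiv (P B)) i) \<longlongrightarrow> coeff (pderiv p) i) F" for i
    unfolding coeff_pderiv by (intro tendsto_intros Suc.prems)
  have IH: "\<forall>\<^sub>F B in F. roots_in (pderiv (P B)) {s<..} = roots_in (pderiv p) {s<..}"
  proof (rule Suc.hyps(1)[OF deg'[symmetric] _ ev conv])
    show "real_rooted (pderiv p)"
      using real_rooted_pderiv[OF Suc.prems(1)] Suc.hyps(2) by simp
    show "poly ((pderiv ^^ j) (pderiv p)) s \<noteq> 0" if "j \<le> degree (pderiv p)" for j
      using Suc.prems(4)[of "Suc j"] that deg' Suc.hyps(2) by (simp add: funpow_swap1)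
  qed
  have nz: "poly p s \<noteq> 0" "poly (pderiv p) s \<noteq> 0"
    using Suc.prems(4)[of 0] Suc.prems(4)[of 1] Suc.hyps(2) by auto
  have lim: "((\<lambda>B. poly (P B) s) \<longlongrightarrow> poly p s) F"
    by (rule tendsto_poly_coeffs) (use Suc.prems(2,3) in \<open>auto elim: eventually_mono\<close>)
  have lim': "((\<lambda>B. poly (pderiv (P B)) s) \<longlongrightarrow> poly (pderiv p) s) F"
    by (rule tendsto_poly_coeffs) (use ev conv in \<open>auto elim: eventually_mono\<close>)
  let ?f = "\<lambda>p. poly p s * poly (pderiv p) s"
  have lim_prod: "((\<lambda>B. ?f (P B)) \<longlongrightarrow> ?f p) F"
    by (intro tendsto_mult lim lim')
  have "\<forall>\<^sub>F B in F. ?f (P B) < 0 \<longleftrightarrow> ?f p < 0"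
  proof (cases "?f p < 0")
    case True
    then show ?thesis
      using order_tendstoD(2)[OF lim_prod True] by simp
  next
    case False
    with nz have "0 < ?f p"
      by (metis linorder_cases mult_eq_0_iff)
    from order_tendstoD(1)[OF lim_prod this] show ?thesis
      by eventually_elim (use False in auto)
  qed
  with IH Suc.prems(2) tendsto_imp_eventually_ne[OF lim nz(1)] tendsto_imp_eventually_ne[OF lim' nz(2)]
  show ?case
  proof eventually_elim
    case (elim B)
    then show ?case
      using Suc.hyps(2) roots_in_greaterThan_pderiv[of "P B" s]
        roots_in_greaterThan_pderiv[OF Suc.prems(1) _ nz] by simp
  qed
qed

text \<open>Ensures that only finitely many points \<open>s\<close> are excluded by the last
  hypothesis of \<open>eventually_roots_in_greaterThan_eq\<close>.\<close>

lemma higher_pderiv_nonzero: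
  fixes p :: "real poly"
  assumes "p \<noteq> 0" "j \<le> degree p"
  shows "(pderiv ^^ j) p \<noteq> 0"
proof -
  have "(pderiv ^^ j) p \<noteq> 0 \<and> degree ((pderiv ^^ j) p) = degree p - j"
    using assms by (induction j) (auto simp: degree_pderiv pderiv_eq_0_iff)
  then show ?thesis ..
qed

lemma finite_negative_gap:
  fixes F :: "real set"
  assumes "finite F"
  obtains s where "s < 0" "\<And>x. x \<in> F \<Longrightarrow> x < 0 \<Longrightarrow> x < s"
proof -
  \<comment> \<open>The extra element keeps the maximum meaningful when \<open>F\<close> has no
    negative element.\<close>
  let ?G = "insert (- 1) {x \<in> F. x < 0}"
  define m where "m = Max ?G"
  have fin: "finite ?G"
    using assms by simp
  have "m \<in> ?G"
    unfolding m_def using fin by (intro Max_in) auto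
  then have "m < 0"
    by auto
  moreover have "x \<le> m" if "x \<in> F" "x < 0" for x
    unfolding m_def using fin that by (intro Max_ge) auto
  ultimately show ?thesis
    by (intro that[of "m / 2"]) force+
qed

text \<open>Zero may itself be a root, where counts are not stable. The count is therefore taken
  from a point \<open>s < 0\<close> so close to zero that it is the same for \<open>Q A\<close>, and
  stability is applied at \<open>s\<close>.\<close>

lemma openin_roots_in_atLeast:
  fixes Q :: "'a::metric_space \<Rightarrow> real poly"
  assumes rr: "\<And>A. A \<in> S \<Longrightarrow> real_rooted (Q A)" and deg: "\<And>A. A \<in> S \<Longrightarrow> degree (Q A) = n"
    and cont: "\<And>i. continuous_on S (\<lambda>A. coeff (Q A) i)"
  shows "openin (top_of_set S) {A \<in> S. roots_in (Q A) {0..} < k}"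
  unfolding openin_euclidean_subtopology_iff
proof (intro conjI ballI)
  fix A assume "A \<in> {A \<in> S. roots_in (Q A) {0..} < k}"
  then have A: "A \<in> S" "roots_in (Q A) {0..} < k"
    by auto
  have nz: "(pderiv ^^ j) (Q A) \<noteq> 0" if "j \<le> n" for j
    using that rr[OF A(1)] deg[OF A(1)] by (intro higher_pderiv_nonzero) (auto simp: real_rooted_def)
  \<comment> \<open>All points at which the stability lemma could fail; the roots of
    \<open>Q A\<close> are the case \<open>j = 0\<close>.\<close>
  define F where "F = (\<Union>j\<le>n. {x. poly ((pderiv ^^ j) (Q A)) x = 0})"
  have "finite F"
    unfolding F_def by (intro finite_UN_I poly_roots_finite nz) auto
  then obtain s where s: "s < 0" "\<And>x. x \<in> F \<Longrightarrow> x < 0 \<Longrightarrow> x < s"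
    by (rule finite_negative_gap) blast
  have "\<forall>\<^sub>F B in at A within S. B \<in> S"
    by (simp add: eventually_at_topological) blast
  then have "\<forall>\<^sub>F B in at A within S. real_rooted (Q B) \<and> degree (Q B) = degree (Q A)"
    by eventually_elim (use A(1) rr deg in auto)
  moreover have "((\<lambda>B. coeff (Q B) i) \<longlongrightarrow> coeff (Q A) i) (at A within S)" for i
    using cont A(1) by (auto simp: continuous_on_def)
  moreover have "poly ((pderiv ^^ j) (Q A)) s \<noteq> 0" if "j \<le> degree (Q A)" for j
    using s that deg[OF A(1)] by (force simp: F_def)
  ultimately have "\<forall>\<^sub>F B in at A within S. roots_in (Q B) {s<..} = roots_in (Q A) {s<..}"
    by (rule eventually_roots_in_greaterThan_eq[OF rr[OF A(1)]])
  moreover have "roots_in (Q A) {s<..} = roots_in (Q A) {0..}"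
  proof (rule roots_in_cong)
    fix x assume "poly (Q A) x = 0"
    then have "x \<in> F"
      by (auto simp: F_def intro!: bexI[of _ 0])
    then show "x \<in> {s<..} \<longleftrightarrow> x \<in> {0..}"
      using s by force
  qed
  ultimately have "\<forall>\<^sub>F B in at A within S. roots_in (Q B) {0..} < k"
  proof (elim eventually_mono)
    fix B assume "roots_in (Q B) {s<..} = roots_in (Q A) {s<..}"
    \<comment> \<open>A nearby \<open>B\<close> may have roots between \<open>s\<close> and 0, so
      only an inequality survives, in the direction that is wanted.\<close>
    moreover have "roots_in (Q B) {0..} \<le> roots_in (Q B) {s<..}"
      by (rule roots_in_mono) (use s in auto)
    ultimately show "roots_in (Q B) {0..} < k"
      using A(2) \<open>roots_in (Q A) {s<..} = roots_in (Q A) {0..}\<close> by linarith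
  qed
  then obtain e where "e > 0" "\<And>B. B \<in> S \<Longrightarrow> B \<noteq> A \<Longrightarrow> dist B A < e \<Longrightarrow> roots_in (Q B) {0..} < k"
    unfolding eventually_at by blast
  then show "\<exists>e>0. \<forall>B\<in>S. dist B A < e \<longrightarrow> B \<in> {A \<in> S. roots_in (Q A) {0..} < k}"
    using A by (intro exI[of _ e]) auto
qed auto

section \<open>Translation of the variable and interiors relative to \<open>Sym2\<close>\<close>

text \<open>One inequality, for all polynomials and shifts, is enough: the other follows by
  translating back.\<close>

lemma order_pcompose_shift:
  fixes p :: "real poly"
  assumes "p \<noteq> 0"
  shows "order x (pcompose p [:c, 1:]) = order (x + c) p"
proof -
  have *: "order (x + c) p \<le> order x (pcompose p [:c, 1:])" if "p \<noteq> 0" for p :: "real poly" and x c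
  proof -
    obtain r where r: "p = [:- (x + c), 1:] ^ order (x + c) p * r"
      using order_1[of "x + c" p] by (elim dvdE)
    have pow: "pcompose (q ^ n) [:c, 1:] = pcompose q [:c, 1:] ^ n" for q n
      by (induction n) (simp_all add: pcompose_1 pcompose_mult)
    have "pcompose p [:c, 1:] = [:- x, 1:] ^ order (x + c) p * pcompose r [:c, 1:]"
      by (subst (1) r) (simp add: pcompose_mult pow pcompose_pCons)
    then have "[:- x, 1:] ^ order (x + c) p dvd pcompose p [:c, 1:]"
      by (metis dvd_triv_left)
    then show ?thesis
      using that by (simp add: order_divides pcompose_eq_0_iff)
  qed
  have "pcompose (pcompose p [:c, 1:]) [:- c, 1:] = p"
    by (simp add: pcompose_pCons flip: pcompose_assoc)
  then show ?thesis
    using *[OF assms, of x c] *[of "pcompose p [:c, 1:]" "x + c" "- c"] assms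
    by (simp add: pcompose_eq_0_iff)
qed

lemma roots_in_pcompose_shift:
  "roots_in (pcompose p [:c, 1:]) {a<..} = roots_in p {a + c<..}"
proof (cases "p = 0")
  case False
  then have nz: "pcompose p [:c, 1:] \<noteq> 0"
    by (simp add: pcompose_eq_0_iff)
  show ?thesis
    unfolding roots_in_eq_sum_order[OF nz] roots_in_eq_sum_order[OF False]
    by (rule sum.reindex_bij_witness[of _ "\<lambda>x. x - c" "\<lambda>x. x + c"])
      (auto simp: order_pcompose_shift[OF False] poly_pcompose add.commute)
qed (simp add: roots_in_def)

text \<open>For maximality, an open \<open>T\<close> containing \<open>A\<close> also contains
  \<open>A - c I\<close> for some \<open>c > 0\<close>. The positive roots there are the roots of
  \<open>Q A\<close> above \<open>- c\<close>, among which are all nonnegative ones.\<close>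

lemma sym_interior_roots_in:
  fixes Q :: "real^'n^'n \<Rightarrow> real poly"
  assumes rr: "\<And>A. A \<in> Sym2 \<Longrightarrow> real_rooted (Q A)" and deg: "\<And>A. A \<in> Sym2 \<Longrightarrow> degree (Q A) = n"
    and cont: "\<And>i. continuous_on Sym2 (\<lambda>A. coeff (Q A) i)"
    and shift: "\<And>A c. A \<in> Sym2 \<Longrightarrow> Q (c *\<^sub>R mat 1 + A) = pcompose (Q A) [:c, 1:]"
  shows "sym_interior {A \<in> Sym2. roots_in (Q A) {0<..} < k} = {A \<in> Sym2. roots_in (Q A) {0..} < k}"
proof (rule interior_of_unique)
  have "roots_in p {0<..} \<le> roots_in p {0..}" for p
    by (rule roots_in_mono) auto
  then show "{A \<in> Sym2. roots_in (Q A) {0..} < k} \<subseteq> {A \<in> Sym2. roots_in (Q A) {0<..} < k}"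
    by (auto intro: le_less_trans)
  show "openin (top_of_set Sym2) {A \<in> Sym2. roots_in (Q A) {0..} < k}"
    by (rule openin_roots_in_atLeast[OF rr deg cont])
  fix T assume T: "T \<subseteq> {A \<in> Sym2. roots_in (Q A) {0<..} < k}" "openin (top_of_set Sym2) T"
  show "T \<subseteq> {A \<in> Sym2. roots_in (Q A) {0..} < k}"
  proof
    fix A assume A: "A \<in> T"
    then have sym: "A \<in> Sym2"
      using T(1) by auto
    obtain e where e: "e > 0" "\<And>B. B \<in> Sym2 \<Longrightarrow> dist B A < e \<Longrightarrow> B \<in> T"
      using T(2) A unfolding openin_euclidean_subtopology_iff by blast
    \<comment> \<open>Adding 1 to the norm makes the distance strictly less than
      \<open>e\<close>.\<close>
    define c where "c = e / (norm (mat 1 :: real^'n^'n) + 1)"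
    have pos: "norm (mat 1 :: real^'n^'n) + 1 > 0"
      using norm_ge_zero[of "mat 1 :: real^'n^'n"] by linarith
    have "c > 0"
      using e(1) pos by (simp add: c_def)
    let ?B = "(- c) *\<^sub>R mat 1 + A"
    have "dist ?B A = c * norm (mat 1 :: real^'n^'n)"
      using \<open>c > 0\<close> by (simp add: dist_norm)
    also have "\<dots> < c * (norm (mat 1 :: real^'n^'n) + 1)"
      using \<open>c > 0\<close> by simp
    also have "\<dots> = e"
      using pos by (simp add: c_def)
    finally have "?B \<in> T"
      using e(2) line_in_Sym2[OF sym] by blast
    then have "roots_in (Q A) {- c<..} < k"
      using T(1) shift[OF sym, of "- c"] roots_in_pcompose_shift[of "Q A" "- c" 0] by auto
    moreover have "roots_in (Q A) {0..} \<le> roots_in (Q A) {- c<..}"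
      by (rule roots_in_mono) (use \<open>c > 0\<close> in auto)
    ultimately show "A \<in> {A \<in> Sym2. roots_in (Q A) {0..} < k}"
      using sym by simp
  qed
qed

section \<open>Garding eigenvalues as root counts\<close>

text \<open>In a sorted list the entries with a downward closed property form an initial
  segment.\<close>

lemma sorted_nth_iff_less_length_filter:
  assumes "sorted xs" "k < length xs" and antimono: "\<And>x y. x \<le> y \<Longrightarrow> P y \<Longrightarrow> P x"
  shows "P (xs ! k) \<longleftrightarrow> k < length (filter P xs)"
  using assms(1,2)
proof (induction xs arbitrary: k)
  case (Cons x xs)
  show ?case
  proof (cases "P x")
    case True
    with Cons show ?thesis
      by (cases k) auto
  next
    case False
    have "x \<le> y" if "y \<in> set (x # xs)" for y
      using Cons.prems(1) that by auto
    then have none: "\<not> P y" if "y \<in> set (x # xs)" for y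
      using that False antimono by blast
    then have "filter P (x # xs) = []"
      by (simp add: filter_empty_conv)
    moreover have "\<not> P ((x # xs) ! k)"
      using none nth_mem[OF Cons.prems(2)] by blast
    ultimately show ?thesis
      by simp
  qed
qed simp

lemma length_filter_garding_eigenvalues:
  "length (filter P (garding_eigenvalues g A)) = roots_in (line_poly g A) {x. P (- x)}"
proof -
  have "length (filter P (garding_eigenvalues g A))
      = size (filter_mset P (mset (garding_eigenvalues g A)))"
    by (simp flip: mset_filter)
  also have "\<dots> = size (filter_mset P (image_mset uminus (proots (line_poly g A))))"
    by (simp add: garding_eigenvalues_def)
  also have "\<dots> = roots_in (line_poly g A) {x. P (- x)}"
    by (simp add: roots_in_def filter_mset_image_mset)
  finally show ?thesis .
qed

lemma length_garding_eigenvalues: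
  "real_rooted (line_poly g A) \<Longrightarrow> length (garding_eigenvalues g A) = degree (line_poly g A)"
  using length_filter_garding_eigenvalues[of "\<lambda>_. True" g A] roots_in_UNIV[of "line_poly g A"] by simp

text \<open>Being negative is downward closed, so the negated claim is proved: the
  \<open>k\<close>-th eigenvalue, at position \<open>k - 1\<close>, is negative iff at least
  \<open>k\<close> roots are positive.\<close>

lemma garding_eigenvalue_nonneg_iff:
  assumes "real_rooted (line_poly g A)" "k \<in> {1..degree (line_poly g A)}"
  shows "0 \<le> garding_eigenvalue g k A \<longleftrightarrow> roots_in (line_poly g A) {0<..} < k"
proof -
  have "garding_eigenvalue g k A < 0 \<longleftrightarrow> k - 1 < length (filter (\<lambda>x. x < 0) (garding_eigenvalues g A))"
    unfolding garding_eigenvalue_def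
    by (rule sorted_nth_iff_less_length_filter)
      (use assms length_garding_eigenvalues[OF assms(1)] in \<open>auto simp: garding_eigenvalues_def\<close>)
  also have "length (filter (\<lambda>x. x < 0) (garding_eigenvalues g A)) = roots_in (line_poly g A) {0<..}"
    by (simp add: length_filter_garding_eigenvalues greaterThan_def)
  finally show ?thesis
    using assms(2) by auto
qed

section \<open>Translation, continuity and degree of the line polynomial\<close>

text \<open>Repeats the induction of \<open>real_polynomial_function_line\<close> uniformly in
  \<open>A\<close>, which shows that the coefficients depend continuously on
  \<open>A\<close>.\<close>

lemma continuous_coeff_real_polynomial_function_line:
  assumes "real_polynomial_function f"
  shows "\<exists>P. (\<forall>A t. poly (P A) t = f (t *\<^sub>R B + A)) \<and> (\<forall>i. continuous_on UNIV (\<lambda>A. coeff (P A) i))"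
  using assms
proof induction
  case (linear f)
  interpret bounded_linear f by fact
  have "continuous_on UNIV (\<lambda>A. coeff [:f A, f B:] i)" for i
    using linear_continuous_on[OF bounded_linear_axioms] by (cases i) (simp_all add: continuous_on_const)
  then show ?case
    by (intro exI[of _ "\<lambda>A. [:f A, f B:]"]) (simp add: add scaleR)
next
  case (const c)
  show ?case
    by (intro exI[of _ "\<lambda>_. [:c:]"]) auto
next
  case (add f g)
  then obtain P Q where "\<forall>A t. poly (P A) t = f (t *\<^sub>R B + A)" "\<forall>i. continuous_on UNIV (\<lambda>A. coeff (P A) i)"
    "\<forall>A t. poly (Q A) t = g (t *\<^sub>R B + A)" "\<forall>i. continuous_on UNIV (\<lambda>A. coeff (Q A) i)"
    by blast
  then show ?case
    by (intro exI[of _ "\<lambda>A. P A + Q A"]) (auto intro!: continuous_intros)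
next
  case (mult f g)
  then obtain P Q where "\<forall>A t. poly (P A) t = f (t *\<^sub>R B + A)" "\<forall>i. continuous_on UNIV (\<lambda>A. coeff (P A) i)"
    "\<forall>A t. poly (Q A) t = g (t *\<^sub>R B + A)" "\<forall>i. continuous_on UNIV (\<lambda>A. coeff (Q A) i)"
    by blast
  then show ?case
    by (intro exI[of _ "\<lambda>A. P A * Q A"]) (auto simp: coeff_mult intro!: continuous_intros)
qed

lemma mat_1_in_Sym2: "mat 1 \<in> Sym2"
  by (auto simp: Sym2_def transpose_def mat_def vec_eq_iff)

context
  fixes m :: nat and g :: "real^'n^'n \<Rightarrow> real"
  assumes hom: "homogeneous_polynomial m g"
begin

lemma line_poly_shift:
  assumes "A \<in> Sym2"
  shows "line_poly g (c *\<^sub>R mat 1 + A) = pcompose (line_poly g A) [:c, 1:]"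
proof (rule poly_line_poly(2)[OF hom line_in_Sym2[OF assms]], rule allI)
  show "poly (pcompose (line_poly g A) [:c, 1:]) t = g (t *\<^sub>R mat 1 + (c *\<^sub>R mat 1 + A))" for t
    by (simp add: poly_pcompose poly_line_poly(1)[OF hom assms] scaleR_add_left add_ac)
qed

lemma continuous_coeff_line_poly: "continuous_on Sym2 (\<lambda>A. coeff (line_poly g A) i)"
proof -
  obtain f where f: "real_polynomial_function f" "\<And>A. A \<in> Sym2 \<Longrightarrow> g A = f A"
    using hom unfolding homogeneous_polynomial_def by blast
  obtain P where P: "\<And>A t. poly (P A) t = f (t *\<^sub>R mat 1 + A)"
    and cont: "\<And>i. continuous_on UNIV (\<lambda>A. coeff (P A) i)"
    using continuous_coeff_real_polynomial_function_line[OF f(1), of "mat 1"] by blast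
  \<comment> \<open>\<open>g\<close> agrees with \<open>f\<close> on \<open>Sym2\<close> only, so
    continuity is obtained on that subspace.\<close>
  have "line_poly g A = P A" if "A \<in> Sym2" for A
    by (rule poly_line_poly(2)[OF hom that]) (simp add: P f(2) line_in_Sym2[OF that])
  then show ?thesis
    using continuous_on_subset[OF cont] by (subst continuous_on_cong[OF refl]) auto
qed

text \<open>
  By homogeneity, \<open>g (t I + A) = t ^ m * g (I + A / t)\<close>: up to powers of \<open>t\<close>, the polynomial
  is the reflection of \<open>s \<mapsto> g (I + s A)\<close>, whose constant coefficient \<open>g I\<close> does not vanish.
\<close>

lemma degree_line_poly:
  assumes "g (mat 1) \<noteq> 0" "A \<in> Sym2"
  shows "degree (line_poly g A) = m" and "line_poly g A \<noteq> 0"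
proof -
  obtain f where f: "real_polynomial_function f" "\<And>A. A \<in> Sym2 \<Longrightarrow> g A = f A"
    using hom unfolding homogeneous_polynomial_def by blast
  obtain q where q: "\<And>s. poly q s = f (s *\<^sub>R A + mat 1)"
    using real_polynomial_function_line[OF f(1)] by blast
  have sym: "s *\<^sub>R A + mat 1 \<in> Sym2" for s
    using assms(2) mat_1_in_Sym2 by (auto simp: Sym2_def transpose_def vec_eq_iff)
  have q0: "coeff q 0 \<noteq> 0"
    using q[of 0] f(2)[OF mat_1_in_Sym2] assms(1) by (simp add: poly_0_coeff_0)
  have ev: "poly (monom 1 (degree q) * line_poly g A) t = poly (monom 1 m * reflect_poly q) t"
    if "t \<noteq> 0" for t
  proof -
    have "t *\<^sub>R mat 1 + A = t *\<^sub>R (inverse t *\<^sub>R A + mat 1)"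
      using that by (simp add: scaleR_add_right)
    then have "poly (line_poly g A) t = t ^ m * poly q (inverse t)"
      using hom sym q f(2)[OF sym] unfolding poly_line_poly(1)[OF hom assms(2)] homogeneous_polynomial_def
      by simp
    then show ?thesis
      using that by (simp add: poly_monom poly_reflect_poly_nz)
  qed
  have "monom 1 (degree q) * line_poly g A = monom 1 m * reflect_poly q"
  proof (rule ccontr)
    assume "\<not> ?thesis"
    then have "finite {t. poly (monom 1 (degree q) * line_poly g A - monom 1 m * reflect_poly q) t = 0}"
      by (intro poly_roots_finite) simp
    moreover have "- {0} \<subseteq> {t. poly (monom 1 (degree q) * line_poly g A - monom 1 m * reflect_poly q) t = 0}"
      using ev by auto
    ultimately have "finite (- {0 :: real})"
      by (rule rev_finite_subset)
    then show False
      by (simp add: Compl_eq_Diff_UNIV infinite_UNIV_char_0)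
  qed
  moreover have "q \<noteq> 0"
    using q0 by auto
  ultimately have "line_poly g A \<noteq> 0 \<and> degree q + degree (line_poly g A) = m + degree q"
    using q0 by (metis degree_monom_eq degree_mult_eq degree_reflect_poly_eq monom_eq_0_iff
        mult_zero_right mult_eq_0_iff one_neq_zero reflect_poly_eq_0_iff)
  then show "degree (line_poly g A) = m" "line_poly g A \<noteq> 0"
    by auto
qed

end

lemma real_rooted_line_poly:
  assumes "garding_hyperbolic m g" "A \<in> Sym2"
  shows "real_rooted (line_poly g A)"
  using assms degree_line_poly(2) unfolding garding_hyperbolic_def by (intro real_rootedI) auto

section \<open>The two top elementary symmetric functions and the derivative\<close>

lemma elem_sym_length: "elem_sym (length xs) xs = (\<Prod>i<length xs. xs ! i)"
proof -
  have "{I. I \<subseteq> {..<length xs} \<and> card I = length xs} = {{..<length xs}}"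
    using card_subset_eq[of "{..<length xs}"] by auto
  then show ?thesis
    by (simp add: elem_sym_def)
qed

text \<open>The index sets are the complements of single positions. For the empty list, truncated
  subtraction would give 1 on the left and 0 on the right.\<close>

lemma elem_sym_length_minus_1:
  assumes "xs \<noteq> []"
  shows "elem_sym (length xs - 1) xs = (\<Sum>j<length xs. \<Prod>i\<in>{..<length xs} - {j}. xs ! i)"
proof -
  let ?N = "{..<length xs}"
  have "{I. I \<subseteq> ?N \<and> card I = length xs - 1} = (\<lambda>j. ?N - {j}) ` ?N" (is "?L = ?R")
  proof
    show "?R \<subseteq> ?L"
      by auto
    show "?L \<subseteq> ?R"
    proof
      fix I assume "I \<in> ?L"
      then have I: "I \<subseteq> ?N" "card I = length xs - 1"
        by auto
      then have "card (?N - I) = 1"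
        using assms by (subst card_Diff_subset) (auto intro: finite_subset simp: Suc_le_eq)
      then obtain j where "?N - I = {j}"
        by (rule card_1_singletonE)
      with I(1) have "j \<in> ?N" "I = ?N - {j}"
        by auto
      then show "I \<in> ?R"
        by blast
    qed
  qed
  moreover have "inj_on (\<lambda>j. ?N - {j}) ?N"
    by (rule inj_onI) auto
  ultimately show ?thesis
    by (simp add: elem_sym_def sum.reindex)
qed

text \<open>The line polynomial is its leading coefficient times the product of all
  \<open>t + xs ! i\<close>; evaluate it and its derivative at zero.\<close>

lemma garding_sigma_line_poly:
  fixes g :: "real^'n^'n \<Rightarrow> real"
  assumes rr: "real_rooted (line_poly g A)" and deg: "degree (line_poly g A) = m"
  shows "garding_sigma g m A = poly (line_poly g A) 0 / lead_coeff (line_poly g A)"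
    and "m > 0 \<Longrightarrow>
      garding_sigma g (m - 1) A = poly (pderiv (line_poly g A)) 0 / lead_coeff (line_poly g A)"
proof -
  define p where "p = line_poly g A"
  define xs where "xs = garding_eigenvalues g A"
  define l where "l = lead_coeff p"
  have len: "length xs = m"
    using length_garding_eigenvalues[OF rr] deg by (simp add: xs_def)
  have "l \<noteq> 0"
    using rr by (simp add: l_def p_def real_rooted_def)
  have "proots p = image_mset uminus (mset xs)"
    by (simp add: xs_def garding_eigenvalues_def p_def image_mset.compositionality o_def)
  then have "p = smult l (\<Prod>x\<in>#mset xs. [:x, 1:])"
    using real_rooted_factor[of p] rr by (simp add: p_def l_def image_mset.compositionality o_def)
  also have "(\<Prod>x\<in>#mset xs. [:x, 1:]) = (\<Prod>i<m. [:xs ! i, 1:])"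
    using prod.list_conv_set_nth[of "map (\<lambda>x. [:x, 1:]) xs"] len
    by (simp add: atLeast0LessThan prod_mset_prod_list flip: mset_map)
  finally have p: "p = smult l (\<Prod>i<m. [:xs ! i, 1:])" .
  have "poly p 0 = l * (\<Prod>i<m. xs ! i)"
    by (subst p) (simp add: poly_prod)
  then show "garding_sigma g m A = poly (line_poly g A) 0 / lead_coeff (line_poly g A)"
    using elem_sym_length[of xs] \<open>l \<noteq> 0\<close> len
    by (simp add: garding_sigma_def xs_def p_def l_def)
  have deriv: "poly (pderiv p) 0 = l * (\<Sum>j<m. \<Prod>i\<in>{..<m} - {j}. xs ! i)"
    by (subst p) (simp add: pderiv_smult pderiv_prod pderiv_pCons poly_sum poly_prod)
  show "garding_sigma g (m - 1) A = poly (pderiv (line_poly g A)) 0 / lead_coeff (line_poly g A)"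
    if "m > 0"
  proof -
    have "xs \<noteq> []"
      using len that by auto
    from elem_sym_length_minus_1[OF this] show ?thesis
      using deriv \<open>l \<noteq> 0\<close> len by (simp add: garding_sigma_def xs_def p_def l_def)
  qed
qed

text \<open>Apply the preceding formula at \<open>t I + A\<close>: the line polynomial there is a
  translate of the one at \<open>A\<close>, with the same leading coefficient.\<close>

lemma line_poly_garding_sigma:
  fixes g :: "real^'n^'n \<Rightarrow> real"
  assumes hyp: "garding_hyperbolic m g" and "m > 0" and A: "A \<in> Sym2"
  shows "line_poly (garding_sigma g (m - 1)) A =
    smult (inverse (lead_coeff (line_poly g A))) (pderiv (line_poly g A))"
proof -
  let ?p = "line_poly g A"
  let ?q = "smult (inverse (lead_coeff ?p)) (pderiv ?p)"
  have hom: "homogeneous_polynomial m g" and nz: "g (mat 1) \<noteq> 0"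
    using hyp by (auto simp: garding_hyperbolic_def)
  have eq: "poly ?q t = garding_sigma g (m - 1) (t *\<^sub>R mat 1 + A)" for t
  proof -
    have sym: "t *\<^sub>R mat 1 + A \<in> Sym2"
      by (rule line_in_Sym2[OF A])
    have "lead_coeff (pcompose ?p [:t, 1:]) = lead_coeff ?p"
      by (subst lead_coeff_comp) auto
    then show ?thesis
      unfolding garding_sigma_line_poly(2)[OF real_rooted_line_poly[OF hyp sym]
          degree_line_poly(1)[OF hom nz sym] \<open>m > 0\<close>]
      unfolding line_poly_shift[OF hom A]
      by (simp add: pderiv_pcompose pderiv_pCons poly_pcompose divide_inverse)
  qed
  show ?thesis
    \<comment> \<open>The computed polynomial is a witness, and real polynomials with equal values
      are equal, which is what \<open>THE\<close> asks for.\<close>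
    unfolding line_poly_def[of "garding_sigma g (m - 1)"]
  proof (rule the_equality)
    show "\<forall>t. poly ?q t = garding_sigma g (m - 1) (t *\<^sub>R mat 1 + A)"
      using eq by blast
    show "r = ?q" if "\<forall>t. poly r t = garding_sigma g (m - 1) (t *\<^sub>R mat 1 + A)" for r
      using that eq by (simp add: poly_eq_poly_eq_iff[symmetric] fun_eq_iff)
  qed
qed

section \<open>Comparison of the root counts of a polynomial and its derivative at zero\<close>

text \<open>Rolle on the right half-line bounds the derivative's count from below; Rolle on the
  left, with the total drop of one, bounds it from above. Only when \<open>p\<close> has exactly
  \<open>k\<close> positive roots and none at zero do these bounds leave the matter open, and the
  sign decides.\<close>

lemma roots_in_pderiv_atLeast_less_iff:
  assumes rr: "real_rooted p" and k: "k \<in> {1..degree p - 1}"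
  shows "roots_in (pderiv p) {0..} < k \<longleftrightarrow>
    roots_in p {0..} < Suc k \<and> (roots_in p {0<..} < k \<or> poly (pderiv p) 0 * poly p 0 < 0)"
proof -
  let ?q = "pderiv p"
  have deg: "degree p > 0"
    using k by auto
  have rr': "real_rooted ?q"
    by (rule real_rooted_pderiv[OF rr deg])
  have nz: "p \<noteq> 0" "?q \<noteq> 0"
    using rr rr' by (auto simp: real_rooted_def)
  have split: "roots_in r {0..} = order 0 r + roots_in r {0<..}"
    "roots_in r UNIV = roots_in r {..0} + roots_in r {0<..}"
    "roots_in r {..0} = roots_in r {..<0} + order 0 r"
    if "r \<noteq> 0" for r
  proof -
    have Un: "{0} \<union> {0<..} = {0::real..}" "{..0} \<union> {0<..} = (UNIV :: real set)" "{..<0} \<union> {0} = {..0::real}"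
      by auto
    have disj: "{..0} \<inter> {0::real<..} = {}"
      by auto
    show "roots_in r {0..} = order 0 r + roots_in r {0<..}"
      "roots_in r UNIV = roots_in r {..0} + roots_in r {0<..}"
      "roots_in r {..0} = roots_in r {..<0} + order 0 r"
      using roots_in_Un_disjoint[of "{0}" "{0<..}" r, unfolded Un]
        roots_in_Un_disjoint[OF disj, of r, unfolded Un]
        roots_in_Un_disjoint[of "{..<0}" "{0}" r, unfolded Un] roots_in_singleton[OF that, of 0]
      by auto
  qed
  have rolle: "roots_in p I \<le> Suc (roots_in ?q I)" if "I \<in> {{0..}, {0<..}, {..0}, {..<0}}" for I
    using that by (intro roots_in_le_Suc_pderiv[OF nz(2)]) (auto simp: is_interval_1)
  have total: "roots_in p UNIV = Suc (roots_in ?q UNIV)"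
    using roots_in_UNIV[OF rr] roots_in_UNIV[OF rr'] deg by (simp add: degree_pderiv)
  have ord: "order 0 p = Suc (order 0 ?q)" if "poly p 0 = 0"
    by (rule order_pderiv[OF nz(1) that])
  consider "roots_in p {0..} \<ge> Suc k" | "roots_in p {0..} < Suc k" "roots_in p {0<..} < k"
    | "roots_in p {0..} < Suc k" "roots_in p {0<..} \<ge> k"
    by linarith
  then show ?thesis
  proof cases
    case 1
    then show ?thesis
      using rolle[of "{0..}"] by simp
  next
    case 2
    have "roots_in ?q {0..} < k"
    proof (cases "poly p 0 = 0")
      case True
      \<comment> \<open>The positive count does not grow, since the loss on \<open>{..0}\<close> is
        at most one, and the order at zero drops by one.\<close>
      then show ?thesis
        using 2 ord split[OF nz(1)] split[OF nz(2)] rolle[of "{..0}"] total by simp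
    next
      case False
      then have "order 0 p = 0"
        by (rule order_0I)
      \<comment> \<open>The loss on \<open>{..<0}\<close> is at most one, so the count on
        \<open>{0..}\<close> does not grow, and for \<open>p\<close> it is the positive
        count.\<close>
      then show ?thesis
        using 2 split[OF nz(1)] split[OF nz(2)] rolle[of "{..<0}"] total by simp
    qed
    with 2 show ?thesis
      by simp
  next
    case 3
    then have "order 0 p = 0" and eq: "roots_in p {0<..} = k"
      using split(1)[OF nz(1)] by auto
    then have p0: "poly p 0 \<noteq> 0"
      using nz(1) by (simp add: order_root)
    show ?thesis
    proof (cases "poly ?q 0 = 0")
      case True
      then have "order 0 ?q > 0"
        using nz(2) by (simp add: order_gt_0_iff)
      \<comment> \<open>At least \<open>k - 1\<close> positive roots of the derivative and its root
        at zero make \<open>k\<close>; the product is 0, so both sides are false.\<close>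
      then show ?thesis
        using True eq split(1)[OF nz(2)] rolle[of "{0<..}"] by simp
    next
      case False
      then show ?thesis
        using 3 eq split(1)[OF nz(2)] order_0I[OF False] roots_in_greaterThan_pderiv[OF rr deg p0 False]
        by (auto simp: mult.commute split: if_splits)
    qed
  qed
qed

theorem proposition7p3:
  fixes g :: "real^'n^'n \<Rightarrow> real" and m k :: nat
  assumes "garding_dirichlet m g"
    and "k \<in> {1..m - 1}"
  shows "sym_interior (branch (garding_sigma g (m - 1)) k) =
           (sym_interior (branch g (k + 1)) \<inter> branch g k) \<union> E_set g m k \<and>
         (sym_interior (branch g (k + 1)) \<inter> branch g k) \<inter> E_set g m k = {}"
proof -
  have hyp: "garding_hyperbolic m g"
    using assms(1) by (simp add: garding_dirichlet_def)
  then have hom: "homogeneous_polynomial m g" and nz: "g (mat 1) \<noteq> 0"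
    by (auto simp: garding_hyperbolic_def)
  have m: "m > 0"
    using assms(2) by auto
  define P where "P = line_poly g"
  have deg: "degree (P A) = m" and rr: "real_rooted (P A)" if "A \<in> Sym2" for A
    using that degree_line_poly(1)[OF hom nz] real_rooted_line_poly[OF hyp] by (auto simp: P_def)
  have deg': "degree (pderiv (P A)) = m - 1" and rr': "real_rooted (pderiv (P A))" if "A \<in> Sym2" for A
    using real_rooted_pderiv[OF rr[OF that]] deg[OF that] m by (auto simp: degree_pderiv)
  have cont: "continuous_on Sym2 (\<lambda>A. coeff (P A) i)" for i
    unfolding P_def by (rule continuous_coeff_line_poly[OF hom])
  have cont': "continuous_on Sym2 (\<lambda>A. coeff (pderiv (P A)) i)" for i
    unfolding coeff_pderiv by (intro continuous_intros cont)
  have shift: "P (c *\<^sub>R mat 1 + A) = pcompose (P A) [:c, 1:]" if "A \<in> Sym2" for A c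
    unfolding P_def by (rule line_poly_shift[OF hom that])
  have shift': "pderiv (P (c *\<^sub>R mat 1 + A)) = pcompose (pderiv (P A)) [:c, 1:]" if "A \<in> Sym2" for A c
    by (simp add: shift[OF that] pderiv_pcompose pderiv_pCons)

  \<comment> \<open>The range of \<open>j\<close> keeps the list access within bounds.\<close>
  have branch: "branch g j = {A \<in> Sym2. roots_in (P A) {0<..} < j}" if "j \<in> {1..m}" for j
    using garding_eigenvalue_nonneg_iff[of g _ j] that rr deg by (auto simp: branch_def P_def)
  have "0 \<le> garding_eigenvalue (garding_sigma g (m - 1)) k A \<longleftrightarrow> roots_in (pderiv (P A)) {0<..} < k"
    if A: "A \<in> Sym2" for A
  proof -
    let ?l = "inverse (lead_coeff (P A))"
    \<comment> \<open>Scaling by a nonzero constant changes neither the roots nor the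
      degree.\<close>
    have l: "?l \<noteq> 0"
      using rr[OF A] by (simp add: real_rooted_def)
    have eq: "line_poly (garding_sigma g (m - 1)) A = smult ?l (pderiv (P A))"
      using line_poly_garding_sigma[OF hyp m A] by (simp add: P_def)
    have "real_rooted (smult ?l (pderiv (P A)))"
      using rr'[OF A] l by (simp add: real_rooted_def)
    moreover have "k \<in> {1..degree (smult ?l (pderiv (P A)))}"
      using l deg'[OF A] assms(2) by simp
    moreover have "roots_in (smult ?l (pderiv (P A))) S = roots_in (pderiv (P A)) S" for S
      using l by (simp add: roots_in_def)
    ultimately show ?thesis
      using garding_eigenvalue_nonneg_iff[of "garding_sigma g (m - 1)" A k, unfolded eq] by metis
  qed
  then have "branch (garding_sigma g (m - 1)) k = {A \<in> Sym2. roots_in (pderiv (P A)) {0<..} < k}"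
    by (auto simp: branch_def)
  then have int_sigma: "sym_interior (branch (garding_sigma g (m - 1)) k) =
      {A \<in> Sym2. roots_in (pderiv (P A)) {0..} < k}"
    using sym_interior_roots_in[OF rr' deg' cont' shift'] by simp
  have k: "k + 1 \<in> {1..m}"
    using assms(2) by auto
  have int_g: "sym_interior (branch g (k + 1)) = {A \<in> Sym2. roots_in (P A) {0..} < Suc k}"
    using sym_interior_roots_in[OF rr deg cont shift] branch[OF k] by simp
  have br_g: "branch g k = {A \<in> Sym2. roots_in (P A) {0<..} < k}"
    using assms(2) by (intro branch) auto
  have sign: "garding_sigma g (m - 1) A * garding_sigma g m A < 0 \<longleftrightarrow> poly (pderiv (P A)) 0 * poly (P A) 0 < 0"
    if A: "A \<in> Sym2" for A
  proof -
    let ?l = "lead_coeff (P A)"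
    \<comment> \<open>The leading coefficient may be negative, but in the product it enters
      squared.\<close>
    have "garding_sigma g (m - 1) A * garding_sigma g m A = poly (pderiv (P A)) 0 * poly (P A) 0 / ?l\<^sup>2"
      using garding_sigma_line_poly[of g A m] rr[OF A] deg[OF A] m by (simp add: P_def power2_eq_square)
    moreover have "?l\<^sup>2 > 0"
      using rr[OF A] by (simp add: real_rooted_def)
    ultimately show ?thesis
      by (simp add: divide_less_0_iff not_less[of "0::real" "?l\<^sup>2"])
  qed
  have "roots_in (pderiv (P A)) {0..} < k \<longleftrightarrow> roots_in (P A) {0..} < Suc k \<and>
      (roots_in (P A) {0<..} < k \<or> garding_sigma g (m - 1) A * garding_sigma g m A < 0)"
    if A: "A \<in> Sym2" for A
    using roots_in_pderiv_atLeast_less_iff[OF rr[OF A], of k] sign[OF A] deg[OF A] assms(2) by simp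
  \<comment> \<open>With every set expressed by root counts the union is propositional; disjointness
    holds because \<open>E_set\<close> removes \<open>branch g k\<close>.\<close>
  then show ?thesis
    unfolding E_set_def int_sigma int_g br_g by blast
qed

end
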